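(* Let $p\ge1$ and let $\mu^{(p)}$ be a (nontrivial) probability measure on the unit circle with $p$-periodic sequence $\{\alpha_n\}_{n=0}^{\infty}$ of Verblunsky coefficients. Let $w$ be a point on the unit circle such that $\varphi_p(w)-\varphi_p^{*}(w)=0$. Then $w$ is a pure point of $\mu^{(p)}$ if, and only if, $$\prod_{j=1}^{p}|1-w\tau_{j-1}(w)\alpha_{j-1}|^{2}<\prod_{j=1}^{p}\left[1-|\alpha_{j-1}|^{2}\right].$$ Moreover, if $w$ is a pure point of $\mu^{(p)}$, then the mass at this point is given by $$\mu^{(p)}(\{w\})=\frac{\gamma}{\gamma+\delta},$$ where $$\delta=\sum_{n=1}^{p}\prod_{j=1}^{n}\frac{|1-w\tau_{j-1}(w)\alpha_{j-1}|^{2}}{1-|\alpha_{j-1}|^{2}}\qquad\text{and}\qquad \gamma=1-\prod_{j=1}^{p}\frac{|1-w\tau_{j-1}(w)\alpha_{j-1}|^{2}}{1-|\alpha_{j-1}|^{2}}.$$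
   Context: A probability measure on the unit circle is nontrivial if its support is infinite. For such a measure $\mu$, $\phi_n$ denotes the monic orthogonal polynomial of degree $n$, $\phi_n^*(z)=z^n\overline{\phi_n(1/\bar z)}$, and $\varphi_n=\kappa_n\phi_n$ with $\kappa_n=\|\phi_n\|_{L^2(\mu)}^{-1}>0$ is the orthonormal polynomial, with $\varphi_n^*=\kappa_n\phi_n^*$. The Verblunsky coefficients are $\alpha_{n-1}=-\overline{\phi_n(0)}$, $n\ge1$; they satisfy $|\alpha_n|<1$. The sequence is $p$-periodic if $\alpha_{n+p}=\alpha_n$ for all $n\ge0$. For $|w|=1$, the sequence $\tau_j(w)$ is defined by $\tau_0(w)=1$ and $$\tau_{j+1}(w)=\frac{\phi_{j+1}(w)}{\phi_{j+1}^*(w)}=\frac{w\tau_j(w)-\overline{\alpha}_j}{1-w\tau_j(w)\alpha_j},\quad j\ge0.$$ A pure point of $\mu$ is a point $w$ with $\mu(\{w\})>0$. *)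

theory Defs
  imports
    "HOL-Probability.Probability"
    "HOL-Computational_Algebra.Polynomial"
begin

definition circle_prob_measure :: "complex measure \<Rightarrow> bool" where
  "circle_prob_measure M \<longleftrightarrow>
     prob_space M \<and> sets M = sets (restrict_space borel (sphere 0 1))"

definition circle_support :: "complex measure \<Rightarrow> complex set" where
  "circle_support M =
     {z \<in> sphere 0 1. \<forall>U. open U \<and> z \<in> U \<longrightarrow> measure M (U \<inter> sphere 0 1) > 0}"

definition nontrivial :: "complex measure \<Rightarrow> bool" where
  "nontrivial M \<longleftrightarrow> infinite (circle_support M)"

text \<open>The description below is meaningful for \<^const>\<open>nontrivial\<close> measures, for which the
  monic orthogonal polynomial of each degree exists and is unique.\<close>

definition monic_OP :: "complex measure \<Rightarrow> nat \<Rightarrow> complex poly" where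
  "monic_OP M n = (THE q. degree q = n \<and> lead_coeff q = 1 \<and>
     (\<forall>k<n. (\<integral>z. poly q z * cnj (z ^ k) \<partial>M) = 0))"

text \<open>The formula for the reversed polynomial is only usable for \<open>z \<noteq> 0\<close>, since
  \<open>1 / 0 = 0\<close>; it is evaluated on the unit circle only.\<close>

definition monic_OP_star :: "complex measure \<Rightarrow> nat \<Rightarrow> complex \<Rightarrow> complex" where
  "monic_OP_star M n z = z ^ n * cnj (poly (monic_OP M n) (1 / cnj z))"

definition OP_kappa :: "complex measure \<Rightarrow> nat \<Rightarrow> real" where
  "OP_kappa M n = 1 / sqrt (\<integral>z. (cmod (poly (monic_OP M n) z))\<^sup>2 \<partial>M)"

definition orthonormal_OP :: "complex measure \<Rightarrow> nat \<Rightarrow> complex \<Rightarrow> complex" where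
  "orthonormal_OP M n z = complex_of_real (OP_kappa M n) * poly (monic_OP M n) z"

definition orthonormal_OP_star :: "complex measure \<Rightarrow> nat \<Rightarrow> complex \<Rightarrow> complex" where
  "orthonormal_OP_star M n z = complex_of_real (OP_kappa M n) * monic_OP_star M n z"

definition verblunsky :: "complex measure \<Rightarrow> nat \<Rightarrow> complex" where
  "verblunsky M n = - cnj (poly (monic_OP M (Suc n)) 0)"

definition periodic_seq :: "nat \<Rightarrow> (nat \<Rightarrow> 'a) \<Rightarrow> bool" where
  "periodic_seq p a \<longleftrightarrow> (\<forall>n. a (n + p) = a n)"

text \<open>By the Szego recurrence, \<open>tau M w (Suc j)\<close> equals
  \<open>(w * tau M w j - cnj a) / (1 - w * tau M w j * a)\<close> for \<open>a = verblunsky M j\<close>, if \<open>cmod w = 1\<close>.\<close>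

fun tau :: "complex measure \<Rightarrow> complex \<Rightarrow> nat \<Rightarrow> complex" where
  "tau M w 0 = 1"
| "tau M w (Suc j) = poly (monic_OP M (Suc j)) w / monic_OP_star M (Suc j) w"

definition pure_point :: "complex measure \<Rightarrow> complex \<Rightarrow> bool" where
  "pure_point M w \<longleftrightarrow> measure M {w} > 0"

end

theory Submission
  imports Defs
begin

text \<open>
  The mass of a point \<open>w\<close> of the circle is the limit of the Christoffel functions
  \<open>1 / (\<Sum>n<N. |\<phi>\<^sub>n(w)|\<^sup>2)\<close>, where \<open>\<phi>\<^sub>n\<close> is the orthonormal polynomial of degree \<open>n\<close>.
  By the reproducing property of the Christoffel-Darboux kernel, this quotient is the minimum of
  \<open>\<integral> |q|\<^sup>2\<close> over the polynomials \<open>q\<close> of degree less than \<open>N\<close> with \<open>q(w) = 1\<close>. Each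
  such integral is at least the mass of \<open>w\<close>, and for powers of a polynomial that peaks at \<open>w\<close>
  the integrals tend to this mass (theorem \<open>christoffel_tendsto_mass\<close>).

  The terms of the sum follow from the Szego recurrence. On the circle, passing from \<open>n\<close> to
  \<open>n + 1\<close> multiplies \<open>|\<phi>\<^sub>n(w)|\<^sup>2\<close> by
  \<open>|1 - w \<tau>\<^sub>n(w) \<alpha>\<^sub>n|\<^sup>2 / (1 - |\<alpha>\<^sub>n|\<^sup>2)\<close>; so the products of the
  statement are values of \<open>|\<phi>\<^sub>n(w)|\<^sup>2\<close>. The hypothesis at \<open>w\<close> says that
  \<open>\<tau>\<^sub>p(w) = 1 = \<tau>\<^sub>0(w)\<close>, and hence \<open>\<tau>\<close> inherits the period of the coefficients.
  Therefore \<open>|\<phi>\<^sub>n\<^sub>+\<^sub>p(w)|\<^sup>2 = R |\<phi>\<^sub>n(w)|\<^sup>2\<close> with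
  \<open>R = |\<phi>\<^sub>p(w)|\<^sup>2\<close>, and the sum over \<open>k\<close> periods is \<open>S (1 + R + \<dots> + R\<^sup>k\<^sup>-\<^sup>1)\<close>,
  where \<open>S\<close> is the sum over the first period. If \<open>R \<ge> 1\<close>, it is unbounded and the mass is
  zero; if \<open>R < 1\<close>, the mass is \<open>(1 - R) / S\<close> (theorem \<open>mass_periodic\<close>). Finally
  \<open>1 - R = \<gamma>\<close>, and \<open>S = \<gamma> + \<delta>\<close> because \<open>\<delta>\<close> sums over \<open>n = 1, \<dots>, p\<close>
  where \<open>S\<close> sums over \<open>n = 0, \<dots>, p - 1\<close>.
\<close>

section \<open>The inner product of polynomials on the circle\<close>

lemma mult_cnj_eq_1:
  assumes "cmod z = 1"
  shows "z * cnj z = 1" "cnj z * z = 1"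
  using complex_norm_square[of z] assms by (simp_all add: mult.commute)

locale nontrivial_circle_measure =
  fixes M :: "complex measure"
  assumes circle: "circle_prob_measure M" and nontriv: "nontrivial M"
begin

definition ip :: "complex poly \<Rightarrow> complex poly \<Rightarrow> complex" where
  "ip p q = (\<integral>z. poly p z * cnj (poly q z) \<partial>M)"

sublocale prob_space M
  using circle by (simp add: circle_prob_measure_def)

lemma sets_M: "sets M = sets (restrict_space borel (sphere 0 1))"
  using circle by (simp add: circle_prob_measure_def)

lemma space_M: "space M = sphere 0 1"
  using sets_eq_imp_space_eq[OF sets_M] by (simp add: space_restrict_space)

lemma borel_inter_circle_sets: "A \<in> sets borel \<Longrightarrow> A \<inter> sphere 0 1 \<in> sets M"
  unfolding sets_M sets_restrict_space by auto

lemma singleton_sets: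
  assumes "cmod w = 1"
  shows "{w} \<in> sets M"
proof -
  have "{w} \<inter> sphere 0 1 = {w}" using assms by auto
  then show ?thesis using borel_inter_circle_sets[of "{w}"] by simp
qed

lemma measurable_continuous:
  fixes f :: "complex \<Rightarrow> 'b::{second_countable_topology, topological_space}"
  assumes "continuous_on UNIV f"
  shows "f \<in> borel_measurable M"
proof -
  have "f \<in> borel_measurable (restrict_space borel (sphere 0 1))"
    using assms by (intro measurable_restrict_space1 borel_measurable_continuous_onI)
  then show ?thesis
    using measurable_cong_sets[OF sets_M refl] by blast
qed

lemma integrable_continuous:
  fixes f :: "complex \<Rightarrow> 'b::{second_countable_topology, banach}"
  assumes "continuous_on UNIV f"
  shows "integrable M f"
proof -
  have "compact (f ` sphere 0 1)"
    using assms by (intro compact_continuous_image continuous_on_subset[OF assms]) auto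
  then obtain B where "\<And>z. z \<in> sphere 0 1 \<Longrightarrow> norm (f z) \<le> B"
    by (meson bounded_iff compact_imp_bounded imageI)
  then show ?thesis
    by (intro integrable_const_bound[of _ B])
       (auto simp: space_M intro!: AE_I2 measurable_continuous assms)
qed

lemma integrable_ip: "integrable M (\<lambda>z. poly p z * cnj (poly q z))"
  by (intro integrable_continuous continuous_intros)

lemma cnj_ip: "cnj (ip p q) = ip q p"
  unfolding ip_def by (simp flip: Bochner_Integration.integral_cnj add: mult.commute)

lemma ip_diff_left: "ip (p - q) r = ip p r - ip q r"
  unfolding ip_def using integrable_ip
  by (simp add: left_diff_distrib flip: Bochner_Integration.integral_diff)

lemma ip_add_left: "ip (p + q) r = ip p r + ip q r"
  unfolding ip_def using integrable_ip
  by (simp add: distrib_right flip: Bochner_Integration.integral_add)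

lemma ip_smult_left: "ip (smult c p) r = c * ip p r"
  unfolding ip_def by (simp add: mult.assoc)

lemma ip_diff_right: "ip r (p - q) = ip r p - ip r q"
  using arg_cong[OF ip_diff_left[of p q r], of cnj] by (simp add: cnj_ip)

lemma ip_add_right: "ip r (p + q) = ip r p + ip r q"
  using arg_cong[OF ip_add_left[of p q r], of cnj] by (simp add: cnj_ip)

lemma ip_smult_right: "ip r (smult c p) = cnj c * ip r p"
  using arg_cong[OF ip_smult_left[of c p r], of cnj] by (simp add: cnj_ip)

lemmas ip_simps = ip_diff_left ip_add_left ip_smult_left ip_diff_right ip_add_right ip_smult_right

lemma ip_self: "ip p p = of_real (\<integral>z. (cmod (poly p z))\<^sup>2 \<partial>M)"
  unfolding ip_def by (simp add: complex_norm_square[symmetric] flip: integral_complex_of_real)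

text \<open>Multiplication by the coordinate is an isometry, because the coordinate has modulus 1 on the circle.\<close>

lemma ip_mult_X: "ip (pCons 0 p) (pCons 0 q) = ip p q"
  unfolding ip_def
proof (intro Bochner_Integration.integral_cong refl)
  fix z assume "z \<in> space M"
  then have "z * cnj z = 1"
    by (simp add: space_M mult_cnj_eq_1)
  then show "poly (pCons 0 p) z * cnj (poly (pCons 0 q) z) = poly p z * cnj (poly q z)"
    by (simp add: mult_ac)
qed

lemma ip_zero_right: "ip p 0 = 0"
  by (simp add: ip_def)

text \<open>A polynomial of norm zero vanishes almost everywhere, so it vanishes on the support. This set is
  infinite, while a nonzero polynomial has finitely many roots. This is the only place where
  nontriviality of the measure enters.\<close>

lemma ip_eq_0_imp_eq_0:
  assumes "ip q q = 0"
  shows "q = 0"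
proof (rule ccontr)
  assume "q \<noteq> 0"
  define R where "R = {z. poly q z = 0}"
  have "finite R"
    using \<open>q \<noteq> 0\<close> unfolding R_def by (rule poly_roots_finite)
  then have "\<not> circle_support M \<subseteq> R"
    using nontriv finite_subset unfolding nontrivial_def by blast
  then obtain z where z: "z \<in> circle_support M" "z \<notin> R" by blast
  have "open (- R)"
    using \<open>finite R\<close> by (simp add: finite_imp_closed open_Compl)
  then have pos: "measure M (- R \<inter> sphere 0 1) > 0"
    using z unfolding circle_support_def by blast
  have "(\<integral>z. (cmod (poly q z))\<^sup>2 \<partial>M) = 0"
    using assms unfolding ip_self by simp
  moreover have "integrable M (\<lambda>z. (cmod (poly q z))\<^sup>2)"
    by (intro integrable_continuous continuous_intros)
  ultimately have "AE z in M. (cmod (poly q z))\<^sup>2 = 0"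
    by (subst (asm) integral_nonneg_eq_0_iff_AE) auto
  then have ae: "AE z in M. z \<notin> - R \<inter> sphere 0 1"
    by eventually_elim (simp add: R_def)
  have "- R \<inter> sphere 0 1 \<in> sets M"
    using \<open>open (- R)\<close> by (intro borel_inter_circle_sets) auto
  moreover have "{z \<in> space M. \<not> z \<notin> - R \<inter> sphere 0 1} = - R \<inter> sphere 0 1"
    unfolding space_M by auto
  ultimately have "emeasure M (- R \<inter> sphere 0 1) = 0"
    using ae by (rule AE_iff_measurable[THEN iffD1])
  then show False
    using pos by (simp add: measure_def)
qed

lemma ip_expand_right:
  "ip q r = (\<Sum>i\<le>degree r. cnj (coeff r i) * ip q (monom 1 i))"
proof -
  have "ip q r = (\<integral>z. (\<Sum>i\<le>degree r. cnj (coeff r i) * (poly q z * cnj (poly (monom 1 i) z))) \<partial>M)"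
    unfolding ip_def poly_altdef[of r]
    by (simp add: sum_distrib_left poly_monom mult_ac)
  also have "\<dots> = (\<Sum>i\<le>degree r. cnj (coeff r i) * ip q (monom 1 i))"
    unfolding ip_def using integrable_ip
    by (subst Bochner_Integration.integral_sum) auto
  finally show ?thesis .
qed

section \<open>Monic orthogonal polynomials and the Szego recurrence\<close>

text \<open>The condition in the definite description that defines \<open>monic_OP\<close>, as a predicate: existence and
  uniqueness have to be established before \<open>monic_OP\<close> has any property.\<close>

definition is_monic_OP :: "nat \<Rightarrow> complex poly \<Rightarrow> bool" where
  "is_monic_OP n q \<longleftrightarrow>
     degree q = n \<and> lead_coeff q = 1 \<and> (\<forall>k<n. ip q (monom 1 k) = 0)"

lemma is_monic_OP_orth:
  assumes "is_monic_OP n q" "degree r < n"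
  shows "ip q r = 0"
  using assms unfolding ip_expand_right[of q r] is_monic_OP_def by (intro sum.neutral) auto

lemma degree_diff_monic:
  fixes q r :: "complex poly"
  assumes "degree q = n" "lead_coeff q = 1" "degree r = n" "lead_coeff r = 1"
  shows "q = r \<or> degree (q - r) < n"
  using assms
  by (metis coeff_diff degree_diff_le eq_iff_diff_eq_0 leading_coeff_0_iff order_le_less)

lemma is_monic_OP_unique:
  assumes q: "is_monic_OP n q" and r: "is_monic_OP n r"
  shows "q = r"
proof (rule ccontr)
  assume "q \<noteq> r"
  then have d: "degree (q - r) < n"
    using degree_diff_monic[of q n r] q r unfolding is_monic_OP_def by auto
  have "ip (q - r) (q - r) = 0"
    using is_monic_OP_orth[OF q d] is_monic_OP_orth[OF r d] by (simp add: ip_diff_left)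
  then show False
    using ip_eq_0_imp_eq_0 \<open>q \<noteq> r\<close> by fastforce
qed

lemma monic_OP_eqI:
  assumes "is_monic_OP n q"
  shows "monic_OP M n = q"
proof -
  have "monic_OP M n = (THE q. is_monic_OP n q)"
    unfolding monic_OP_def is_monic_OP_def ip_def by (simp add: poly_monom)
  then show ?thesis
    using assms is_monic_OP_unique by (simp add: the_equality)
qed

lemma ip_monom_degree:
  assumes "is_monic_OP n q"
  shows "ip q (monom 1 n) = ip q q"
proof -
  have "q = monom 1 n \<or> degree (q - monom 1 n) < n"
    using assms unfolding is_monic_OP_def by (intro degree_diff_monic) (auto simp: degree_monom_eq)
  then have "ip q (q - monom 1 n) = 0"
    using is_monic_OP_orth[OF assms] by (auto simp: ip_zero_right)
  then show ?thesis by (simp add: ip_diff_right)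
qed

text \<open>The Szego dual \<open>q\<^sup>*\<close> as a polynomial. It has the expected meaning at \<open>0\<close> as well, unlike
  \<open>monic_OP_star\<close>; this is needed to read off the Verblunsky coefficient.\<close>

definition reversed :: "complex poly \<Rightarrow> complex poly" where
  "reversed q = reflect_poly (map_poly cnj q)"

lemma poly_reversed:
  assumes "cmod z = 1"
  shows "poly (reversed q) z = z ^ degree q * cnj (poly q z)"
proof -
  have z: "cnj (inverse z) = z"
    using assms complex_norm_square[of z]
    by (metis complex_cnj_inverse complex_mod_cnj inverse_unique mult.commute of_real_1 power_one complex_cnj_cnj)
  have "z \<noteq> 0" using assms by auto
  then have "poly (reversed q) z = z ^ degree q * poly (map_poly cnj q) (inverse z)"
    unfolding reversed_def by (simp add: poly_reflect_poly_nz degree_map_poly)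
  also have "poly (map_poly cnj q) (inverse z) = cnj (poly q z)"
    using z by simp
  finally show ?thesis .
qed

lemma degree_reversed: "degree (reversed q) \<le> degree q"
  unfolding reversed_def by (metis degree_reflect_poly_le degree_map_poly complex_cnj_zero_iff)

lemma reversed_at_0: "poly (reversed q) 0 = cnj (lead_coeff q)"
  unfolding reversed_def by (simp add: degree_map_poly coeff_map_poly)

text \<open>For a monic orthogonal \<open>q\<close> of degree \<open>n\<close>, this makes the reversed polynomial orthogonal to
  \<open>z, \<dots>, z\<^sup>n\<close>.\<close>

lemma ip_reversed_monom:
  assumes "k \<le> degree q"
  shows "ip (reversed q) (monom 1 k) = cnj (ip q (monom 1 (degree q - k)))"
  unfolding cnj_ip unfolding ip_def
proof (intro Bochner_Integration.integral_cong refl)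
  fix z assume "z \<in> space M"
  then have z: "cmod z = 1" by (simp add: space_M)
  then have "z * cnj z = 1" by (simp add: mult_cnj_eq_1)
  then have "z ^ k * cnj z ^ k = 1" by (metis power_mult_distrib power_one)
  moreover have "z ^ degree q = z ^ (degree q - k) * z ^ k"
    using assms by (simp flip: power_add)
  ultimately have "z ^ degree q * cnj z ^ k = z ^ (degree q - k)"
    by (simp add: mult.assoc)
  then show "poly (reversed q) z * cnj (poly (monom 1 k) z) =
      poly (monom 1 (degree q - k)) z * cnj (poly q z)"
    by (simp add: poly_reversed z poly_monom mult_ac)
qed

lemma ip_reversed_self: "ip (reversed q) (reversed q) = ip q q"
  unfolding ip_self of_real_eq_iff
  by (intro Bochner_Integration.integral_cong refl)
     (simp add: space_M poly_reversed norm_mult norm_power)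

text \<open>The Szego recurrence, used as a construction. Both \<open>z q\<close> and the reversed polynomial are
  orthogonal to \<open>z, \<dots>, z\<^sup>n\<close>, so one free coefficient suffices to make the combination
  orthogonal to \<open>1\<close> as well. This is possible because the inner product of the reversed polynomial
  with \<open>1\<close> is the squared norm of \<open>q\<close>, which is positive.\<close>

lemma is_monic_OP_step:
  assumes q: "is_monic_OP n q"
  shows "\<exists>a. is_monic_OP (Suc n) (pCons 0 q - smult a (reversed q))"
proof -
  have deg: "degree q = n" and lead: "lead_coeff q = 1" using q by (auto simp: is_monic_OP_def)
  then have "q \<noteq> 0" by auto
  then have nz: "ip q q \<noteq> 0" using ip_eq_0_imp_eq_0 by blast
  define a where "a = ip (pCons 0 q) (monom 1 0) / ip q q"
  define r where "r = pCons 0 q - smult a (reversed q)"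
  have d: "degree (smult a (reversed q)) < degree (pCons 0 q)"
    using degree_reversed[of q] \<open>q \<noteq> 0\<close> by (auto intro: le_less_trans[OF degree_smult_le])
  have dr: "degree r = Suc n"
    unfolding r_def diff_conv_add_uminus
    using d \<open>q \<noteq> 0\<close> deg by (subst degree_add_eq_left) auto
  have "coeff (smult a (reversed q)) (Suc n) = 0"
    using d deg \<open>q \<noteq> 0\<close> by (intro coeff_eq_0) simp
  then have lr: "lead_coeff r = 1"
    unfolding dr using lead deg by (simp add: r_def)
  have "ip r (monom 1 k) = 0" if "k < Suc n" for k
  proof (cases k)
    case 0
    have "ip (reversed q) (monom 1 0) = ip q q"
      using ip_reversed_monom[of 0 q] ip_monom_degree[OF q] deg cnj_ip by simp
    then show ?thesis using nz by (simp add: 0 r_def ip_simps a_def)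
  next
    case (Suc l)
    have "ip (pCons 0 q) (monom 1 k) = ip q (monom 1 l)"
      using Suc by (simp add: monom_Suc ip_mult_X)
    also have "\<dots> = 0" using q Suc that by (auto simp: is_monic_OP_def)
    finally have 1: "ip (pCons 0 q) (monom 1 k) = 0" .
    have "ip (reversed q) (monom 1 k) = 0"
      using ip_reversed_monom[of k q] q Suc that by (simp add: is_monic_OP_def)
    with 1 show ?thesis by (simp add: r_def ip_simps)
  qed
  then have "is_monic_OP (Suc n) r" using dr lr by (simp add: is_monic_OP_def)
  then show ?thesis unfolding r_def by blast
qed

abbreviation \<Phi> :: "nat \<Rightarrow> complex poly" where "\<Phi> n \<equiv> monic_OP M n"
abbreviation \<alpha> :: "nat \<Rightarrow> complex" where "\<alpha> n \<equiv> verblunsky M n"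

lemma is_monic_OP_monic_OP: "is_monic_OP n (\<Phi> n)"
proof -
  have "\<exists>q. is_monic_OP n q"
  proof (induction n)
    case 0
    have "is_monic_OP 0 1" by (simp add: is_monic_OP_def)
    then show ?case ..
  next
    case (Suc n)
    then show ?case using is_monic_OP_step by blast
  qed
  then show ?thesis using monic_OP_eqI by blast
qed

lemma monic_OP_0: "\<Phi> 0 = 1"
  by (rule monic_OP_eqI) (simp add: is_monic_OP_def)

lemma degree_monic_OP: "degree (\<Phi> n) = n" and lead_coeff_monic_OP: "lead_coeff (\<Phi> n) = 1"
  using is_monic_OP_monic_OP[of n] by (auto simp: is_monic_OP_def)

lemma monic_OP_orth: "degree r < n \<Longrightarrow> ip (\<Phi> n) r = 0"
  using is_monic_OP_orth[OF is_monic_OP_monic_OP] .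

text \<open>The coefficient in the construction is identified by evaluation at \<open>0\<close>, where the reversed monic
  polynomial takes the value \<open>1\<close>.\<close>

lemma szego_recurrence: "\<Phi> (Suc n) = pCons 0 (\<Phi> n) - smult (cnj (\<alpha> n)) (reversed (\<Phi> n))"
proof -
  obtain a where "is_monic_OP (Suc n) (pCons 0 (\<Phi> n) - smult a (reversed (\<Phi> n)))"
    using is_monic_OP_step[OF is_monic_OP_monic_OP] by blast
  then have eq: "\<Phi> (Suc n) = pCons 0 (\<Phi> n) - smult a (reversed (\<Phi> n))"
    by (rule monic_OP_eqI)
  have "cnj (\<alpha> n) = a"
    by (simp add: verblunsky_def eq reversed_at_0 lead_coeff_monic_OP)
  then show ?thesis using eq by simp
qed

definition sqnorm :: "nat \<Rightarrow> real" where
  "sqnorm n = (\<integral>z. (cmod (poly (\<Phi> n) z))\<^sup>2 \<partial>M)"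

lemma ip_monic_OP_self: "ip (\<Phi> n) (\<Phi> n) = of_real (sqnorm n)"
  by (simp add: ip_self sqnorm_def)

lemma sqnorm_pos: "sqnorm n > 0"
proof -
  have "\<Phi> n \<noteq> 0" using lead_coeff_monic_OP[of n] by auto
  then have "sqnorm n \<noteq> 0" using ip_eq_0_imp_eq_0[of "\<Phi> n"] ip_monic_OP_self[of n] by auto
  moreover have "sqnorm n \<ge> 0" unfolding sqnorm_def by simp
  ultimately show ?thesis by simp
qed

lemma sqnorm_0: "sqnorm 0 = 1"
  by (simp add: sqnorm_def monic_OP_0 prob_space)

text \<open>Pythagoras: by the recurrence, \<open>z \<Phi>\<^sub>n\<close> is the sum of \<open>\<Phi>\<^sub>n\<^sub>+\<^sub>1\<close> and a multiple of the
  reversed polynomial. The two are orthogonal, since the latter has degree at most \<open>n\<close>.\<close>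

lemma sqnorm_Suc: "sqnorm (Suc n) = (1 - (cmod (\<alpha> n))\<^sup>2) * sqnorm n"
proof -
  let ?F = "\<Phi> (Suc n)" and ?r = "reversed (\<Phi> n)"
  have X: "pCons 0 (\<Phi> n) = ?F + smult (cnj (\<alpha> n)) ?r"
    by (simp add: szego_recurrence)
  have o: "ip ?F ?r = 0"
    using degree_reversed[of "\<Phi> n"] by (intro monic_OP_orth) (simp add: degree_monic_OP)
  then have o': "ip ?r ?F = 0" using cnj_ip by (metis complex_cnj_zero)
  have "ip (\<Phi> n) (\<Phi> n) = ip (pCons 0 (\<Phi> n)) (pCons 0 (\<Phi> n))" by (rule ip_mult_X[symmetric])
  also have "\<dots> = ip ?F ?F + of_real ((cmod (\<alpha> n))\<^sup>2) * ip (\<Phi> n) (\<Phi> n)"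
    unfolding X complex_norm_square by (simp add: ip_simps o o' ip_reversed_self mult_ac)
  finally have "complex_of_real (sqnorm n) = of_real (sqnorm (Suc n) + (cmod (\<alpha> n))\<^sup>2 * sqnorm n)"
    by (simp add: ip_monic_OP_self)
  then have "sqnorm n = sqnorm (Suc n) + (cmod (\<alpha> n))\<^sup>2 * sqnorm n"
    unfolding of_real_eq_iff .
  then show ?thesis by (simp add: algebra_simps)
qed

lemma one_minus_verblunsky_pos: "1 - (cmod (\<alpha> n))\<^sup>2 > 0"
  using sqnorm_Suc[of n] sqnorm_pos[of n] sqnorm_pos[of "Suc n"] by (simp add: zero_less_mult_iff)

section \<open>The Christoffel function and the mass of a point\<close>

text \<open>The Christoffel-Darboux kernel, as a polynomial in its first variable.\<close>

definition kernel :: "complex \<Rightarrow> nat \<Rightarrow> complex poly" where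
  "kernel w N = (\<Sum>n<N. smult (cnj (poly (\<Phi> n) w) / of_real (sqnorm n)) (\<Phi> n))"

text \<open>The squared modulus \<open>|\<phi>\<^sub>n(w)|\<^sup>2\<close> of the orthonormal polynomial.\<close>

definition intensity :: "complex \<Rightarrow> nat \<Rightarrow> real" where
  "intensity w n = (cmod (poly (\<Phi> n) w))\<^sup>2 / sqnorm n"

lemma kernel_Suc:
  "kernel w (Suc N) = kernel w N + smult (cnj (poly (\<Phi> N) w) / of_real (sqnorm N)) (\<Phi> N)"
  by (simp add: kernel_def)

lemma degree_kernel: "degree (kernel w (Suc N)) \<le> N"
  unfolding kernel_def by (intro degree_sum_le) (auto simp: degree_monic_OP)

lemma poly_kernel: "poly (kernel w N) w = of_real (\<Sum>n<N. intensity w n)"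
  unfolding kernel_def poly_sum of_real_sum intensity_def of_real_divide complex_norm_square
  by (simp add: mult_ac)

text \<open>Induction on \<open>N\<close>: subtracting the right multiple of \<open>\<Phi>\<^sub>N\<close> lowers the degree bound, and \<open>\<Phi>\<^sub>N\<close>
  is orthogonal both to the rest and to the previous kernel. The bound is expressed in the proof
  by vanishing coefficients, which also covers the zero polynomial at \<open>N = 0\<close>.\<close>

lemma kernel_reproducing:
  assumes "degree q < N"
  shows "ip q (kernel w N) = poly q w"
proof -
  have "ip q (kernel w N) = poly q w" if "\<forall>i\<ge>N. coeff q i = 0" for q
    using that
  proof (induction N arbitrary: q)
    case 0
    then have "q = 0" by (simp add: poly_eq_iff)
    then show ?case by (simp add: kernel_def ip_zero_right)
  next
    case (Suc N)
    define c where "c = coeff q N"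
    define r where "r = q - smult c (\<Phi> N)"
    have lead: "coeff (\<Phi> N) N = 1"
      using lead_coeff_monic_OP[of N] by (simp add: degree_monic_OP)
    have r: "\<forall>i\<ge>N. coeff r i = 0"
    proof (intro allI impI)
      fix i assume "i \<ge> N"
      then show "coeff r i = 0"
        using Suc.prems lead
        by (cases "i = N") (auto simp: r_def c_def coeff_eq_0 degree_monic_OP)
    qed
    have orth_r: "ip r (\<Phi> N) = 0"
    proof (cases "r = 0")
      case True
      then show ?thesis by (simp add: ip_def)
    next
      case False
      then have "degree r < N" using r by (metis leading_coeff_0_iff not_less)
      then show ?thesis using monic_OP_orth cnj_ip by (metis complex_cnj_zero)
    qed
    have orth_k: "ip (\<Phi> N) (kernel w N) = 0"
    proof (cases N)
      case 0
      then show ?thesis by (simp add: kernel_def ip_zero_right)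
    next
      case (Suc m)
      then show ?thesis using degree_kernel[of w m] by (intro monic_OP_orth) simp
    qed
    have q: "q = r + smult c (\<Phi> N)" by (simp add: r_def)
    have "ip q (kernel w (Suc N)) = poly r w + c * poly (\<Phi> N) w"
      using Suc.IH[OF r] orth_r orth_k sqnorm_pos[of N]
      unfolding q kernel_Suc by (simp add: ip_simps ip_monic_OP_self)
    then show ?case by (simp add: q)
  qed
  then show ?thesis using assms by (simp add: coeff_eq_0)
qed

lemma ip_kernel_self: "ip (kernel w N) (kernel w N) = of_real (\<Sum>n<N. intensity w n)"
proof (cases N)
  case 0
  then show ?thesis by (simp add: kernel_def ip_def)
next
  case (Suc m)
  then show ?thesis
    using kernel_reproducing[of "kernel w N" N w] degree_kernel[of w m] poly_kernel[of w N] by simp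
qed

lemma intensity_nonneg: "intensity w n \<ge> 0"
  unfolding intensity_def using sqnorm_pos[of n] by simp

lemma intensity_0: "intensity w 0 = 1"
  by (simp add: intensity_def monic_OP_0 sqnorm_0)

lemma kernel_diag_pos:
  assumes "N > 0"
  shows "(\<Sum>n<N. intensity w n) > 0"
  using assms by (intro sum_pos2[of _ 0]) (auto simp: intensity_0 intensity_nonneg)

text \<open>The right-hand side minus the left-hand side is the squared norm of
  \<open>q - k / K\<close>, where \<open>k\<close> is the kernel and \<open>K\<close> its value at \<open>w\<close>: by the reproducing property
  \<open>k / K\<close> is the orthogonal projection of \<open>q\<close> onto the line spanned by \<open>k\<close>.\<close>

lemma christoffel_lower:
  assumes "degree q < N" "poly q w = 1"
  shows "1 / (\<Sum>n<N. intensity w n) \<le> (\<integral>z. (cmod (poly q z))\<^sup>2 \<partial>M)"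
proof -
  define K where "K = (\<Sum>n<N. intensity w n)"
  define L where "L = (\<integral>z. (cmod (poly q z))\<^sup>2 \<partial>M)"
  let ?k = "smult (of_real (1 / K)) (kernel w N)"
  have K: "K > 0" unfolding K_def using assms by (intro kernel_diag_pos) auto
  have qk: "ip q (kernel w N) = 1" using kernel_reproducing assms by simp
  then have kq: "ip (kernel w N) q = 1" using cnj_ip by (metis complex_cnj_one)
  have "ip (q - ?k) (q - ?k) = of_real (L - 1 / K)"
    using K ip_kernel_self[of w N]
    by (simp add: ip_simps qk kq ip_self[of q] field_simps flip: K_def L_def)
  then have "of_real (L - 1 / K) = complex_of_real (\<integral>z. (cmod (poly (q - ?k) z))\<^sup>2 \<partial>M)"
    unfolding ip_self by simp
  then have "L - 1 / K = (\<integral>z. (cmod (poly (q - ?k) z))\<^sup>2 \<partial>M)"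
    unfolding of_real_eq_iff .
  also have "\<dots> \<ge> 0" by simp
  finally show ?thesis by (simp add: K_def L_def)
qed

text \<open>The kernel \<open>k\<close> takes the value \<open>K\<close> at \<open>w\<close> and has squared norm \<open>K\<close>, so the point \<open>w\<close> alone
  contributes \<open>K\<^sup>2\<close> times its mass to an integral of size \<open>K\<close>.\<close>

lemma mass_le_christoffel:
  assumes w: "cmod w = 1" and "N > 0"
  shows "measure M {w} \<le> 1 / (\<Sum>n<N. intensity w n)"
proof -
  define K where "K = (\<Sum>n<N. intensity w n)"
  have K: "K > 0" unfolding K_def using assms by (intro kernel_diag_pos) auto
  have "measure M {w} * K\<^sup>2 = (\<integral>z. K\<^sup>2 * indicator {w} z \<partial>M)"
    using singleton_sets[OF w] by simp
  also have "\<dots> \<le> (\<integral>z. (cmod (poly (kernel w N) z))\<^sup>2 \<partial>M)"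
  proof (rule integral_mono)
    show "integrable M (\<lambda>z. K\<^sup>2 * indicator {w} z :: real)"
      using singleton_sets[OF w] by (simp add: emeasure_eq_measure)
    show "integrable M (\<lambda>z. (cmod (poly (kernel w N) z))\<^sup>2)"
      by (intro integrable_continuous continuous_intros)
    show "K\<^sup>2 * indicator {w} z \<le> (cmod (poly (kernel w N) z))\<^sup>2" for z
      by (cases "z = w") (simp_all add: poly_kernel K_def del: of_real_sum)
  qed
  also have "\<dots> = K"
    using ip_self[of "kernel w N"] unfolding ip_kernel_self of_real_eq_iff K_def by simp
  finally show ?thesis using K by (simp add: K_def[symmetric] field_simps power2_eq_square)
qed

lemma cmod_one_plus_less:
  fixes u :: complex
  assumes "cmod u = 1" "u \<noteq> 1"
  shows "cmod (1 + u) < 2"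
proof -
  have n: "(Re u)\<^sup>2 + (Im u)\<^sup>2 = 1" using assms(1) cmod_power2[of u] by simp
  have "Re u < 1"
  proof (rule ccontr)
    assume "\<not> Re u < 1"
    moreover have "Re u \<le> 1" using complex_Re_le_cmod[of u] assms by simp
    ultimately have "Re u = 1" by simp
    then have "Im u = 0" using n by simp
    then show False using \<open>Re u = 1\<close> assms(2) by (simp add: complex_eq_iff)
  qed
  moreover have "(cmod (1 + u))\<^sup>2 = 2 + 2 * Re u"
    using n unfolding cmod_power2 by (simp add: power2_eq_square algebra_simps)
  ultimately have "(cmod (1 + u))\<^sup>2 < 2\<^sup>2" by simp
  then show ?thesis by (rule power_less_imp_less_base) simp
qed

text \<open>The polynomial \<open>(1 + z / w) / 2\<close> has modulus 1 at \<open>w\<close> and less than 1 elsewhere on the circle, so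
  the squared moduli of its powers decrease to the indicator function of \<open>w\<close>, dominated by 1.\<close>

lemma peak_integral_tendsto:
  assumes w: "cmod w = 1"
  shows "(\<lambda>N. \<integral>z. (cmod (poly ([:1/2, cnj w / 2:] ^ N) z))\<^sup>2 \<partial>M) \<longlonglongrightarrow> measure M {w}"
proof -
  define g where "g z = (cmod (poly [:1/2, cnj w / 2:] z))\<^sup>2" for z
  have cont: "continuous_on UNIV (\<lambda>z. g z ^ N)" for N
    unfolding g_def by (intro continuous_intros)
  have g_w: "g w = 1"
    using w by (simp add: g_def mult_cnj_eq_1 flip: add_divide_distrib)
  have g_nonneg: "0 \<le> g z" for z by (simp add: g_def)
  have g_less: "g z < 1" if "cmod z = 1" "z \<noteq> w" for z
  proof -
    have "z * cnj w \<noteq> 1"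
    proof
      assume "z * cnj w = 1"
      then have "w = z * (cnj w * w)" by (simp flip: mult.assoc)
      then show False using w that by (simp add: mult_cnj_eq_1)
    qed
    then have "cmod (1 + z * cnj w) < 2"
      using that w by (intro cmod_one_plus_less) (auto simp: norm_mult)
    moreover have "cmod (poly [:1/2, cnj w / 2:] z) = cmod (1 + z * cnj w) / 2"
      by (simp flip: add_divide_distrib add: norm_divide)
    ultimately show ?thesis by (simp add: g_def power_less_one_iff abs_square_less_1)
  qed
  have "(\<lambda>N. \<integral>z. g z ^ N \<partial>M) \<longlonglongrightarrow> (\<integral>z. indicator {w} z \<partial>M)"
  proof (rule integral_dominated_convergence)
    show "AE z in M. (\<lambda>N. g z ^ N) \<longlonglongrightarrow> indicator {w} z"
    proof (rule AE_I2)
      fix z assume "z \<in> space M"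
      then have "cmod z = 1" by (simp add: space_M)
      then show "(\<lambda>N. g z ^ N) \<longlonglongrightarrow> indicator {w} z"
        using g_less[of z] g_nonneg[of z] g_w by (cases "z = w") (auto intro: LIMSEQ_realpow_zero)
    qed
    show "AE z in M. norm (g z ^ N) \<le> 1" for N
    proof (rule AE_I2)
      fix z assume "z \<in> space M"
      then have "g z \<le> 1" using g_less[of z] g_w by (cases "z = w") (auto simp: space_M)
      then show "norm (g z ^ N) \<le> 1" using g_nonneg[of z] by (simp add: power_le_one)
    qed
  qed (use singleton_sets[OF w] cont in \<open>auto intro: measurable_continuous\<close>)
  moreover have "(cmod (poly ([:1/2, cnj w / 2:] ^ N) z))\<^sup>2 = g z ^ N" for N z
    unfolding g_def poly_power norm_power by (simp flip: power_mult add: mult.commute)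
  ultimately show ?thesis using singleton_sets[OF w] by simp
qed

theorem christoffel_tendsto_mass:
  assumes w: "cmod w = 1"
  shows "(\<lambda>N. 1 / (\<Sum>n<N. intensity w n)) \<longlonglongrightarrow> measure M {w}"
proof -
  let ?q = "[:1/2, cnj w / 2:]"
  have "(\<lambda>N. 1 / (\<Sum>n<Suc N. intensity w n)) \<longlonglongrightarrow> measure M {w}"
  proof (rule tendsto_sandwich[OF _ _ tendsto_const peak_integral_tendsto[OF w]])
    show "\<forall>\<^sub>F N in sequentially. measure M {w} \<le> 1 / (\<Sum>n<Suc N. intensity w n)"
      using mass_le_christoffel[OF w] by (intro always_eventually) blast
    show "\<forall>\<^sub>F N in sequentially. 1 / (\<Sum>n<Suc N. intensity w n)
        \<le> (\<integral>z. (cmod (poly (?q ^ N) z))\<^sup>2 \<partial>M)"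
    proof (intro always_eventually allI christoffel_lower)
      fix N
      have "degree (?q ^ N) \<le> degree ?q * N" by (rule degree_power_le)
      also have "\<dots> \<le> 1 * N" by (intro mult_right_mono) auto
      finally show "degree (?q ^ N) < Suc N" by simp
      have "poly ?q w = 1" using w by (simp add: mult_cnj_eq_1 flip: add_divide_distrib)
      then show "poly (?q ^ N) w = 1" by simp
    qed
  qed
  then show ?thesis by (rule LIMSEQ_imp_Suc)
qed

section \<open>The intensities along the recurrence\<close>

text \<open>The factor by which the intensity at a point of the circle changes from \<open>j\<close> to \<open>j + 1\<close>.\<close>

definition growth :: "complex \<Rightarrow> nat \<Rightarrow> real" where
  "growth w j = (cmod (1 - w * tau M w j * \<alpha> j))\<^sup>2 / (1 - (cmod (\<alpha> j))\<^sup>2)"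

lemma monic_OP_star_circle:
  assumes "cmod w = 1"
  shows "monic_OP_star M n w = w ^ n * cnj (poly (\<Phi> n) w)"
proof -
  have "w * cnj w = 1" using assms by (simp add: mult_cnj_eq_1)
  then have "1 / cnj w = w" by (metis div_by_1 mult.right_neutral nonzero_eq_divide_eq mult_zero_right zero_neq_one)
  then show ?thesis by (simp add: monic_OP_star_def)
qed

lemma monic_OP_Suc_circle:
  assumes "cmod w = 1"
  shows "poly (\<Phi> (Suc n)) w = w * poly (\<Phi> n) w - cnj (\<alpha> n) * monic_OP_star M n w"
  by (simp add: szego_recurrence poly_reversed assms degree_monic_OP monic_OP_star_circle)

lemma monic_OP_star_Suc_circle:
  assumes "cmod w = 1"
  shows "monic_OP_star M (Suc n) w = monic_OP_star M n w - \<alpha> n * w * poly (\<Phi> n) w"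
proof -
  have 1: "w * cnj w = 1" using assms by (simp add: mult_cnj_eq_1)
  have 2: "w ^ n * cnj w ^ n = 1" using 1 by (metis power_mult_distrib power_one)
  have "monic_OP_star M (Suc n) w =
      (w * cnj w) * (w ^ n * cnj (poly (\<Phi> n) w)) - \<alpha> n * w * (w ^ n * cnj w ^ n) * poly (\<Phi> n) w"
    by (simp add: monic_OP_star_circle assms monic_OP_Suc_circle algebra_simps)
  then show ?thesis unfolding 1 2 by (simp add: monic_OP_star_circle assms)
qed

lemma cmod_monic_OP_star:
  assumes "cmod w = 1"
  shows "cmod (monic_OP_star M n w) = cmod (poly (\<Phi> n) w)"
  by (simp add: monic_OP_star_circle assms norm_mult norm_power)

lemma cmod_verblunsky_less_1: "cmod (\<alpha> n) < 1"
  using one_minus_verblunsky_pos[of n] by (simp add: abs_square_less_1)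

text \<open>Since \<open>|\<Phi>\<^sub>n\<^sup>*| = |\<Phi>\<^sub>n|\<close> on the circle and \<open>|\<alpha>\<^sub>n| < 1\<close>, the correction in the dual
  recurrence is too small to produce a zero.\<close>

lemma monic_OP_star_nonzero:
  assumes w: "cmod w = 1"
  shows "monic_OP_star M n w \<noteq> 0"
proof (induction n)
  case 0
  then show ?case by (simp add: monic_OP_star_circle w monic_OP_0)
next
  case (Suc n)
  have "cmod (\<alpha> n * w * poly (\<Phi> n) w) < cmod (monic_OP_star M n w)"
    using Suc cmod_verblunsky_less_1[of n] w
    by (simp add: norm_mult flip: cmod_monic_OP_star[OF w])
  then show ?case by (auto simp: monic_OP_star_Suc_circle w)
qed

lemma tau_eq:
  assumes "cmod w = 1"
  shows "tau M w n = poly (\<Phi> n) w / monic_OP_star M n w"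
  using assms by (cases n) (simp_all add: monic_OP_0 monic_OP_star_circle)

lemma tau_Suc:
  assumes w: "cmod w = 1"
  shows "tau M w (Suc n) = (w * tau M w n - cnj (\<alpha> n)) / (1 - w * tau M w n * \<alpha> n)"
proof -
  let ?s = "monic_OP_star M n w"
  have s: "?s \<noteq> 0" using monic_OP_star_nonzero[OF w] .
  have "poly (\<Phi> (Suc n)) w = ?s * (w * tau M w n - cnj (\<alpha> n))"
    using s by (simp add: monic_OP_Suc_circle w tau_eq field_simps)
  moreover have "monic_OP_star M (Suc n) w = ?s * (1 - w * tau M w n * \<alpha> n)"
    using s by (simp add: monic_OP_star_Suc_circle w tau_eq field_simps)
  ultimately show ?thesis using s by (simp add: tau_eq[OF w, of "Suc n"])
qed

lemma intensity_Suc: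
  assumes w: "cmod w = 1"
  shows "intensity w (Suc n) = intensity w n * growth w n"
proof -
  let ?s = "monic_OP_star M n w"
  have s: "?s \<noteq> 0" using monic_OP_star_nonzero[OF w] .
  have "monic_OP_star M (Suc n) w = ?s * (1 - w * tau M w n * \<alpha> n)"
    using s by (simp add: monic_OP_star_Suc_circle w tau_eq field_simps)
  then show ?thesis
    by (simp add: intensity_def growth_def sqnorm_Suc norm_mult power_mult_distrib mult.commute
        flip: cmod_monic_OP_star[OF w])
qed

lemma intensity_prod:
  assumes "cmod w = 1"
  shows "intensity w n = (\<Prod>j<n. growth w j)"
  by (induction n) (simp_all add: intensity_0 intensity_Suc assms)

lemma OP_kappa_nonzero: "OP_kappa M n \<noteq> 0"
  using sqnorm_pos[of n] by (simp add: OP_kappa_def flip: sqnorm_def)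

text \<open>The hypothesis on \<open>w\<close> enters only through this value: the normalising factor and the dual
  polynomial do not vanish, so they can be divided out.\<close>

lemma tau_eq_1:
  assumes "cmod w = 1" "orthonormal_OP M p w - orthonormal_OP_star M p w = 0"
  shows "tau M w p = 1"
  using assms monic_OP_star_nonzero[of w p] OP_kappa_nonzero[of p]
  by (simp add: tau_eq orthonormal_OP_def orthonormal_OP_star_def)

text \<open>The value \<open>1\<close> at \<open>p\<close> restarts the recursion for \<open>\<tau>\<close>, whose coefficients are periodic.\<close>

lemma tau_periodic:
  assumes "cmod w = 1" "tau M w p = 1" "periodic_seq p \<alpha>"
  shows "tau M w (n + p) = tau M w n"
proof (induction n)
  case 0
  then show ?case using assms(2) by simp
next
  case (Suc n)
  then show ?case
    using assms(3) by (simp only: add_Suc tau_Suc[OF assms(1)] periodic_seq_def)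
qed

lemma intensity_shift:
  assumes "cmod w = 1" "tau M w p = 1" "periodic_seq p \<alpha>"
  shows "intensity w (n + p) = intensity w p * intensity w n"
proof (induction n)
  case 0
  then show ?case by (simp add: intensity_0)
next
  case (Suc n)
  have "growth w (n + p) = growth w n"
    using assms tau_periodic by (simp add: growth_def periodic_seq_def)
  then show ?case using Suc assms(1) by (simp add: intensity_Suc)
qed

lemma kernel_diag_multiple:
  assumes "cmod w = 1" "tau M w p = 1" "periodic_seq p \<alpha>"
  shows "(\<Sum>n<k * p. intensity w n) = (\<Sum>n<p. intensity w n) * (\<Sum>i<k. intensity w p ^ i)"
proof (induction k)
  case (Suc k)
  have pow: "intensity w (n + k * p) = intensity w p ^ k * intensity w n" for n k
  proof (induction k)
    case (Suc k)
    have "intensity w (n + Suc k * p) = intensity w ((n + k * p) + p)" by (simp add: ac_simps)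
    then show ?case using Suc intensity_shift[OF assms] by simp
  qed simp
  have split: "(\<Sum>n<a + b. f n) = (\<Sum>n<a. f n) + (\<Sum>n<b. f (n + a))" for f :: "nat \<Rightarrow> real" and a b
    by (induction b) (simp_all add: add_ac)
  have "(\<Sum>n<Suc k * p. intensity w n) = (\<Sum>n<k * p. intensity w n) + (\<Sum>n<p. intensity w (n + k * p))"
    using split[of "intensity w" "k * p" p] by (simp add: add.commute)
  also have "(\<Sum>n<p. intensity w (n + k * p)) = intensity w p ^ k * (\<Sum>n<p. intensity w n)"
    by (simp add: pow sum_distrib_left)
  finally show ?case using Suc by (simp add: algebra_simps)
qed simp

text \<open>Along the multiples of \<open>p\<close>, the Christoffel functions are reciprocals of partial sums of a
  geometric series with ratio \<open>intensity w p\<close>.\<close>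

theorem mass_periodic:
  assumes w: "cmod w = 1" "tau M w p = 1" "periodic_seq p \<alpha>" and "p \<ge> 1"
  shows "measure M {w} =
     (if intensity w p < 1 then (1 - intensity w p) / (\<Sum>n<p. intensity w n) else 0)"
proof -
  define R where "R = intensity w p"
  define S where "S = (\<Sum>n<p. intensity w n)"
  have S: "S > 0" unfolding S_def using kernel_diag_pos \<open>p \<ge> 1\<close> by simp
  have "strict_mono (\<lambda>k. k * p)" using \<open>p \<ge> 1\<close> by (intro strict_monoI) simp
  from LIMSEQ_subseq_LIMSEQ[OF christoffel_tendsto_mass[OF w(1)] this]
  have lim: "(\<lambda>k. 1 / (S * (\<Sum>i<k. R ^ i))) \<longlonglongrightarrow> measure M {w}"
    by (simp add: o_def kernel_diag_multiple[OF w] S_def R_def)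
  show ?thesis
  proof (cases "R < 1")
    case True
    have "norm R < 1" using True intensity_nonneg[of w p] by (simp add: R_def)
    then have "(\<lambda>k. \<Sum>i<k. R ^ i) \<longlonglongrightarrow> 1 / (1 - R)" using geometric_sums[of R] by (simp add: sums_def)
    then have "(\<lambda>k. 1 / (S * (\<Sum>i<k. R ^ i))) \<longlonglongrightarrow> 1 / (S * (1 / (1 - R)))"
      using S True by (intro tendsto_intros) auto
    with lim have "measure M {w} = 1 / (S * (1 / (1 - R)))" by (rule LIMSEQ_unique)
    then show ?thesis using True by (simp flip: R_def S_def)
  next
    case False
    have "(\<lambda>k. 1 / (S * (\<Sum>i<k. R ^ i))) \<longlonglongrightarrow> 0"
    proof (rule tendsto_sandwich[OF _ _ tendsto_const])
      show "(\<lambda>k. (1 / S) * (1 / real k)) \<longlonglongrightarrow> 0" using lim_1_over_n by (rule tendsto_mult_right_zero)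
      show "\<forall>\<^sub>F k in sequentially. 0 \<le> 1 / (S * (\<Sum>i<k. R ^ i))"
        using S False by (intro always_eventually allI divide_nonneg_nonneg mult_nonneg_nonneg sum_nonneg) auto
      show "\<forall>\<^sub>F k in sequentially. 1 / (S * (\<Sum>i<k. R ^ i)) \<le> (1 / S) * (1 / real k)"
      proof (rule eventually_sequentiallyI[of 1])
        fix k :: nat assume "1 \<le> k"
        have "real k \<le> (\<Sum>i<k. R ^ i)"
          using False sum_mono[of "{..<k}" "\<lambda>_. 1" "\<lambda>i. R ^ i"] by (simp add: one_le_power)
        then show "1 / (S * (\<Sum>i<k. R ^ i)) \<le> (1 / S) * (1 / real k)"
          using S \<open>1 \<le> k\<close> by (simp add: frac_le)
      qed
    qed
    with lim have "measure M {w} = 0" by (rule LIMSEQ_unique)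
    then show ?thesis using False by (simp flip: R_def)
  qed
qed

end

theorem theorem4p4:
  fixes M :: "complex measure" and p :: nat and w :: complex
  assumes "p \<ge> 1"
    and "circle_prob_measure M"
    and "nontrivial M"
    and "periodic_seq p (verblunsky M)"
    and "cmod w = 1"
    and "orthonormal_OP M p w - orthonormal_OP_star M p w = 0"
  shows "(pure_point M w \<longleftrightarrow>
            (\<Prod>j=1..p. (cmod (1 - w * tau M w (j - 1) * verblunsky M (j - 1)))\<^sup>2)
              < (\<Prod>j=1..p. 1 - (cmod (verblunsky M (j - 1)))\<^sup>2)) \<and>
         (pure_point M w \<longrightarrow>
            (let \<delta> = (\<Sum>n=1..p. \<Prod>j=1..n.
                   (cmod (1 - w * tau M w (j - 1) * verblunsky M (j - 1)))\<^sup>2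
                     / (1 - (cmod (verblunsky M (j - 1)))\<^sup>2));
                 \<gamma> = 1 - (\<Prod>j=1..p.
                   (cmod (1 - w * tau M w (j - 1) * verblunsky M (j - 1)))\<^sup>2
                     / (1 - (cmod (verblunsky M (j - 1)))\<^sup>2))
             in measure M {w} = \<gamma> / (\<gamma> + \<delta>)))"
proof -
  interpret nontrivial_circle_measure M
    using assms by unfold_locales auto
  note per = assms(5) tau_eq_1[OF assms(5,6)] assms(4)
  have prod: "(\<Prod>j=1..n. (cmod (1 - w * tau M w (j - 1) * verblunsky M (j - 1)))\<^sup>2
      / (1 - (cmod (verblunsky M (j - 1)))\<^sup>2)) = intensity w n" for n
    unfolding intensity_prod[OF assms(5)] growth_def
    by (rule prod.reindex_bij_witness[of _ Suc "\<lambda>j. j - 1"]) auto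
  define R where "R = intensity w p"
  define S where "S = (\<Sum>n<p. intensity w n)"
  have S: "S > 0" unfolding S_def using kernel_diag_pos \<open>p \<ge> 1\<close> by simp
  have mass: "measure M {w} = (if R < 1 then (1 - R) / S else 0)"
    unfolding R_def S_def by (rule mass_periodic[OF per \<open>p \<ge> 1\<close>])
  then have pp: "pure_point M w \<longleftrightarrow> R < 1"
    using S by (simp add: pure_point_def)
  have "(\<Prod>j=1..p. 1 - (cmod (verblunsky M (j - 1)))\<^sup>2) > 0"
    by (intro prod_pos ballI one_minus_verblunsky_pos)
  then have "R < 1 \<longleftrightarrow> (\<Prod>j=1..p. (cmod (1 - w * tau M w (j - 1) * verblunsky M (j - 1)))\<^sup>2)
      < (\<Prod>j=1..p. 1 - (cmod (verblunsky M (j - 1)))\<^sup>2)"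
    unfolding R_def prod[symmetric] prod_dividef by simp
  moreover have "(1 - R) + (\<Sum>n=1..p. intensity w n) = S"
  proof -
    have "S + R = (\<Sum>n\<le>p. intensity w n)"
      by (simp add: S_def R_def lessThan_Suc_atMost[symmetric])
    also have "\<dots> = 1 + (\<Sum>n=1..p. intensity w n)"
      by (simp add: atMost_atLeast0 sum.atLeast_Suc_atMost intensity_0)
    finally show ?thesis by simp
  qed
  ultimately show ?thesis
    unfolding prod Let_def using pp mass by (simp flip: R_def)
qed

end
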